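(* Let a dual variable $\bm{\tau}=(\tau_i)_{i\in\mathcal V}$, $\tau_i\geqslant 0$, be given. Let $\bm{\alpha}^{*}=[\bm{\alpha}^{*}_{1},\bm{\alpha}^{*}_{2},\dots,\bm{\alpha}^{*}_{V}]^{T}$ be the optimal knowledge base construction (KBC) solution to the inner problem $(\mathrm{I}_{\bm\tau})$, where $\bm{\alpha}^{*}_{i}$ represents the optimal KBC policy of vehicle user $i$. Then for every $i\in\mathcal V$ there exists $j\in\mathcal V_i$ such that $\bm{\alpha}^{*}_{i_{(j)}}=\bm{\alpha}^{*}_{i}$, where $\bm{\alpha}^{*}_{i_{(j)}}$ is the optimal KBC sub-policy of vehicle user $i$ obtained by solving the pair subproblem for the pair $i,j$.
   Context: Setting. $\mathcal V=\{1,\dots,V\}$ is a set of vehicle users (VUEs) and $\mathcal K=\{1,\dots,N\}$ a library of knowledge bases (KBs). Each VUE $i$ has the neighbor set $\mathcal V_i=\{j\in\mathcal V: j\neq i,\ \gamma_{i,j}\geqslant\gamma_0\}$, where $\gamma_{i,j}$ is the signal-to-interference-plus-noise ratio of the link between $i$ and $j$ and $\gamma_0$ is a threshold; $j\in\mathcal V_i$ if and only if $i\in\mathcal V_j$. Given parameters: KB storage sizes $s_n$; VUE storage capacities $C_i$; total packet arrival rates $\lambda_i$; mean interpretation times $1/\mu_i^n$ of KB $n$-based packets at VUE $i$; a threshold $\eta_0$; and Zipf preferences $p_i^n=(r_i^n)^{-\xi_i}/\sum_{e\in\mathcal K}e^{-\xi_i}$, where $\xi_i\geqslant 0$ and $r_i^n$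 is the popularity rank of KB $n$ at VUE $i$. Put $\lambda_i^n=\lambda_i p_i^n$. KBC variables: $\alpha_i^n\in\{0,1\}$ ($\alpha_i^n=1$ if KB $n$ is constructed at VUE $i$), $\bm\alpha_i=(\alpha_i^n)_{n\in\mathcal K}$, $\bm\alpha=(\bm\alpha_i)_{i\in\mathcal V}$. Pairing variables: $\beta_{i\looparrowright j}\in\{0,1\}$ ($i\in\mathcal V$, $j\in\mathcal V_i$; equal to $1$ if sender $i$ is associated with receiver $j$), $\bm\beta=(\beta_{i\looparrowright j})$. Derived quantities, for $i\in\mathcal V$, $j\in\mathcal V_i$: - $\eta_i=\sum_{n\in\mathcal K}\alpha_i^n p_i^n$. - $\theta_{i\looparrowright j}=\dfrac{\sum_{n}\alpha_i^n(1-\alpha_j^n)\lambda_i^n}{\sum_n\alpha_i^n\lambda_i^n}$. - With $\lambda^{\mathit{eff}}_{i\looparrowright j}=\sum_n\alpha_i^n\alpha_j^n\lambda_i^n$, $\epsilon^n_{i\looparrowright j}=p_i^n/\sum_{f\in\mathcal K}\alpha_i^f\alpha_j^f p_i^f$, $E_{i\looparrowright j}=\sum_n\alpha_i^n\alpha_j^n\epsilon^n_{i\looparrowright j}/\mu_j^n$ and $S_{i\looparrowright j}=\sum_n\alpha_i^n\alpha_j^n(\epsilon^n_{i\looparrowright j}/\mu_j^n)^2$, the average queuing latency is $$\delta_{i\looparrowright j}=\frac{\lambda^{\mathit{eff}}_{i\looparrowright j}\,(E_{i\looparrowright j}^2+S_{i\looparrowright j})}{2(1-\lambda^{\mathit{eff}}_{i\looparrowright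 j}E_{i\looparrowright j})}.$$ It is assumed that $\lambda^{\mathit{eff}}_{i\looparrowright j}E_{i\looparrowright j}<1$ (steady state of the queue). Inner problem $(\mathrm{I}_{\bm\tau})$: minimize over $(\bm\alpha,\bm\beta)$ $$\widetilde L_{\bm\tau}(\bm\alpha,\bm\beta)=\sum_{i\in\mathcal V}\sum_{j\in\mathcal V_i}\beta_{i\looparrowright j}(\delta_{i\looparrowright j}+\tau_i\theta_{i\looparrowright j})$$ subject to $\sum_{n}\alpha_i^n s_n\leqslant C_i$ and $\eta_i\geqslant\eta_0$ for all $i\in\mathcal V$; $\sum_{j\in\mathcal V_i}\beta_{i\looparrowright j}=1$ for all $i\in\mathcal V$; $\beta_{i\looparrowright j}=\beta_{j\looparrowright i}$ for all $i\in\mathcal V$, $j\in\mathcal V_i$; all $\alpha_i^n,\beta_{i\looparrowright j}\in\{0,1\}$. Pair subproblem for the pair $i,j$ ($i\in\mathcal V$, $j\in\mathcal V_i$; one problem per unordered pair, since $\omega_{i,j}=\omega_{j,i}$): minimize over $\bm\alpha_i,\bm\alpha_j\in\{0,1\}^N$ $$\omega_{i,j}=(\delta_{i\looparrowright j}+\tau_i\theta_{i\looparrowright j})+(\delta_{j\looparrowright i}+\tau_j\theta_{j\looparrowright i})$$ subject to $\sum_n\alpha_i^n s_n\leqslant C_i$, $\sum_n\alpha_j^n s_n\leqslant C_j$, $\eta_i\geqslant\eta_0$, $\eta_j\geqslant\eta_0$. Solving it gives the optimal KBC sub-policies of the two VUEs, denoted $\bm\alpha^*_{i_{(j)}}$ (for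 VUE $i$) and $\bm\alpha^*_{j_{(i)}}$ (for VUE $j$). *)

theory Defs
  imports Complex_Main "HOL-Library.FuncSet"
begin

record network =
  num_vues :: nat
  num_kbs :: nat
  sinr :: "nat \<Rightarrow> nat \<Rightarrow> real"
  sinr_threshold :: real
  kb_size :: "nat \<Rightarrow> real"
  capacity :: "nat \<Rightarrow> real"
  arrival_rate :: "nat \<Rightarrow> real"
  interp_rate :: "nat \<Rightarrow> nat \<Rightarrow> real"  \<comment> \<open>VUE, then KB; mean interpretation time is the reciprocal\<close>
  pref_threshold :: real
  zipf_skewness :: "nat \<Rightarrow> real"
  pop_rank :: "nat \<Rightarrow> nat \<Rightarrow> nat"  \<comment> \<open>VUE, then KB\<close>

definition vues :: "network \<Rightarrow> nat set" where
  "vues G = {1..num_vues G}"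

definition kbs :: "network \<Rightarrow> nat set" where
  "kbs G = {1..num_kbs G}"

definition neighbors :: "network \<Rightarrow> nat \<Rightarrow> nat set" where
  "neighbors G i = {j \<in> vues G. j \<noteq> i \<and> sinr G i j \<ge> sinr_threshold G}"

definition pref :: "network \<Rightarrow> nat \<Rightarrow> nat \<Rightarrow> real" where
  "pref G i n = real (pop_rank G i n) powr (- zipf_skewness G i)
     / (\<Sum>e\<in>kbs G. real e powr (- zipf_skewness G i))"

definition kb_arrival_rate :: "network \<Rightarrow> nat \<Rightarrow> nat \<Rightarrow> real" where
  "kb_arrival_rate G i n = arrival_rate G i * pref G i n"

text \<open>
  A KBC policy of a single VUE is a 0/1-vector indexed by the KBs. It is represented by an
  extensional function, so that equality of policies is equality of functions.
\<close>

type_synonym kbc_policy = "nat \<Rightarrow> real"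

definition kbc_policies :: "network \<Rightarrow> kbc_policy set" where
  "kbc_policies G = kbs G \<rightarrow>\<^sub>E {0, 1}"

definition pref_satisfaction :: "network \<Rightarrow> nat \<Rightarrow> kbc_policy \<Rightarrow> real" where
  "pref_satisfaction G i a = (\<Sum>n\<in>kbs G. a n * pref G i n)"

definition vue_feasible :: "network \<Rightarrow> nat \<Rightarrow> kbc_policy \<Rightarrow> bool" where
  "vue_feasible G i a \<longleftrightarrow>
     a \<in> kbc_policies G \<and>
     (\<Sum>n\<in>kbs G. a n * kb_size G n) \<le> capacity G i \<and>
     pref_satisfaction G i a \<ge> pref_threshold G"

text \<open>
  Below, \<open>i\<close> is the sender with policy \<open>a\<close> and \<open>j\<close> the receiver with policy \<open>b\<close>. By \<open>x / 0 = 0\<close>,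
  the latency is 0 if \<open>a\<close> and \<open>b\<close> share no KB (no packet is then queued), and the mismatch is 0 if
  its denominator vanishes.
\<close>

definition mismatch :: "network \<Rightarrow> nat \<Rightarrow> kbc_policy \<Rightarrow> kbc_policy \<Rightarrow> real" where
  "mismatch G i a b =
     (\<Sum>n\<in>kbs G. a n * (1 - b n) * kb_arrival_rate G i n)
     / (\<Sum>n\<in>kbs G. a n * kb_arrival_rate G i n)"

definition eff_rate :: "network \<Rightarrow> nat \<Rightarrow> kbc_policy \<Rightarrow> kbc_policy \<Rightarrow> real" where
  "eff_rate G i a b = (\<Sum>n\<in>kbs G. a n * b n * kb_arrival_rate G i n)"

definition packet_ratio :: "network \<Rightarrow> nat \<Rightarrow> kbc_policy \<Rightarrow> kbc_policy \<Rightarrow> nat \<Rightarrow> real" where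
  "packet_ratio G i a b n = pref G i n / (\<Sum>f\<in>kbs G. a f * b f * pref G i f)"

definition interp_mean ::
    "network \<Rightarrow> nat \<Rightarrow> nat \<Rightarrow> kbc_policy \<Rightarrow> kbc_policy \<Rightarrow> real" where
  "interp_mean G i j a b =
     (\<Sum>n\<in>kbs G. a n * b n * (packet_ratio G i a b n / interp_rate G j n))"

definition interp_sq ::
    "network \<Rightarrow> nat \<Rightarrow> nat \<Rightarrow> kbc_policy \<Rightarrow> kbc_policy \<Rightarrow> real" where
  "interp_sq G i j a b =
     (\<Sum>n\<in>kbs G. a n * b n * (packet_ratio G i a b n / interp_rate G j n)\<^sup>2)"

definition latency ::
    "network \<Rightarrow> nat \<Rightarrow> nat \<Rightarrow> kbc_policy \<Rightarrow> kbc_policy \<Rightarrow> real" where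
  "latency G i j a b =
     eff_rate G i a b * ((interp_mean G i j a b)\<^sup>2 + interp_sq G i j a b)
     / (2 * (1 - eff_rate G i a b * interp_mean G i j a b))"

definition inner_objective ::
    "network \<Rightarrow> (nat \<Rightarrow> real) \<Rightarrow> (nat \<Rightarrow> kbc_policy) \<times> (nat \<Rightarrow> nat \<Rightarrow> real) \<Rightarrow> real" where
  "inner_objective G \<tau> = (\<lambda>(\<alpha>, \<beta>).
     \<Sum>i\<in>vues G. \<Sum>j\<in>neighbors G i.
       \<beta> i j * (latency G i j (\<alpha> i) (\<alpha> j) + \<tau> i * mismatch G i (\<alpha> i) (\<alpha> j)))"

definition inner_feasible ::
    "network \<Rightarrow> (nat \<Rightarrow> kbc_policy) \<times> (nat \<Rightarrow> nat \<Rightarrow> real) \<Rightarrow> bool" where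
  "inner_feasible G = (\<lambda>(\<alpha>, \<beta>).
     (\<forall>i\<in>vues G. vue_feasible G i (\<alpha> i)) \<and>
     (\<forall>i\<in>vues G. (\<Sum>j\<in>neighbors G i. \<beta> i j) = 1) \<and>
     (\<forall>i\<in>vues G. \<forall>j\<in>neighbors G i. \<beta> i j = \<beta> j i) \<and>
     (\<forall>i\<in>vues G. \<forall>j\<in>neighbors G i. \<beta> i j \<in> {0, 1}))"

definition pair_objective ::
    "network \<Rightarrow> (nat \<Rightarrow> real) \<Rightarrow> nat \<Rightarrow> nat \<Rightarrow> kbc_policy \<times> kbc_policy \<Rightarrow> real" where
  "pair_objective G \<tau> i j = (\<lambda>(a, b).
     (latency G i j a b + \<tau> i * mismatch G i a b)
     + (latency G j i b a + \<tau> j * mismatch G j b a))"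

definition pair_feasible ::
    "network \<Rightarrow> nat \<Rightarrow> nat \<Rightarrow> kbc_policy \<times> kbc_policy \<Rightarrow> bool" where
  "pair_feasible G i j = (\<lambda>(a, b). vue_feasible G i a \<and> vue_feasible G j b)"

end

theory Submission
  imports Defs
begin

text \<open>
  A feasible \<open>\<beta>\<close> is a perfect matching of the VUEs along neighbor pairs, so the inner objective is
  a sum of pair objectives over disjoint pairs. Replacing the policies of one matched pair by a
  better solution of its pair subproblem keeps feasibility and changes no other summand; hence the
  restriction of an optimum to a matched pair is optimal for that pair.
\<close>

text \<open>A sum different from 0 has a nonzero term, here equal to 1; the other terms are
  nonnegative with sum 0, so each of them vanishes.\<close>

lemma sum_zero_one_eq_1_obtain:
  fixes f :: "'a \<Rightarrow> real"
  assumes "finite A" and "\<forall>x\<in>A. f x \<in> {0, 1}" and "sum f A = 1"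
  obtains y where "y \<in> A" and "\<And>x. x \<in> A \<Longrightarrow> f x = of_bool (x = y)"
proof -
  obtain y where y: "y \<in> A" "f y \<noteq> 0"
    using assms(3) by (metis sum.neutral zero_neq_one)
  then have "f y = 1" using assms(2) by blast
  then have "sum f (A - {y}) = 0"
    using assms(1,3) y(1) by (simp add: sum_diff1)
  then have "f x = 0" if "x \<in> A - {y}" for x
    using that assms(1,2) sum_nonneg_eq_0_iff[of "A - {y}" f] by fastforce
  with y(1) \<open>f y = 1\<close> show thesis by (intro that[of y]) auto
qed

lemma finite_vues [simp]: "finite (vues G)"
  by (simp add: vues_def)

lemma finite_neighbors [simp]: "finite (neighbors G i)"
  by (simp add: neighbors_def)

text \<open>The coefficient of \<open>\<beta> i j\<close> in the inner objective; a pair objective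
  adds the costs of its two directions.\<close>

definition link_cost ::
    "network \<Rightarrow> (nat \<Rightarrow> real) \<Rightarrow> nat \<Rightarrow> nat \<Rightarrow> kbc_policy \<Rightarrow> kbc_policy \<Rightarrow> real" where
  "link_cost G \<tau> i j a b = latency G i j a b + \<tau> i * mismatch G i a b"

text \<open>Each row of \<beta> contains exactly one 1, in column \<open>m i\<close>. Symmetry of
  \<beta> turns \<open>m\<close> into an involution, that is, a perfect matching.\<close>

lemma inner_feasible_matching:
  assumes "inner_feasible G (\<alpha>, \<beta>)"
    and sym: "\<forall>i\<in>vues G. \<forall>j\<in>vues G. j \<in> neighbors G i \<longleftrightarrow> i \<in> neighbors G j"
  obtains m where "\<And>i. i \<in> vues G \<Longrightarrow> m i \<in> neighbors G i"
    and "\<And>i. i \<in> vues G \<Longrightarrow> m (m i) = i"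
    and "\<And>i j. i \<in> vues G \<Longrightarrow> j \<in> neighbors G i \<Longrightarrow> \<beta> i j = of_bool (j = m i)"
proof -
  have one: "(\<Sum>j\<in>neighbors G i. \<beta> i j) = 1"
    and bin: "\<forall>j\<in>neighbors G i. \<beta> i j \<in> {0, 1}"
    and comm: "\<forall>j\<in>neighbors G i. \<beta> i j = \<beta> j i" if "i \<in> vues G" for i
    using assms(1) that unfolding inner_feasible_def by blast+
  have "\<exists>y. y \<in> neighbors G i \<and> (\<forall>j\<in>neighbors G i. \<beta> i j = of_bool (j = y))"
    if "i \<in> vues G" for i
    using sum_zero_one_eq_1_obtain[OF finite_neighbors bin[OF that] one[OF that]] by metis
  then obtain m where m: "\<And>i. i \<in> vues G \<Longrightarrow> m i \<in> neighbors G i"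
    "\<And>i j. i \<in> vues G \<Longrightarrow> j \<in> neighbors G i \<Longrightarrow> \<beta> i j = of_bool (j = m i)"
    by metis
  have "m (m i) = i" if i: "i \<in> vues G" for i
  proof -
    have mi: "m i \<in> vues G" using m(1)[OF i] by (simp add: neighbors_def)
    \<comment> \<open>Row \<open>m i\<close> of \<beta> is known only on the neighbors of
      \<open>m i\<close>, so \<open>i\<close> has to be one of them before
      \<open>\<beta> (m i) i = 1\<close> can force \<open>i = m (m i)\<close>.\<close>
    then have "i \<in> neighbors G (m i)" using sym i m(1) by blast
    moreover have "\<beta> (m i) i = 1" using comm[OF i] m i by force
    ultimately show ?thesis using m(2)[OF mi] by (metis of_bool_eq(1) zero_neq_one)
  qed
  with m show thesis by (intro that[of m]) auto
qed

text \<open>Only the entry \<open>j = m i\<close> of row \<open>i\<close> survives. The policies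
  \<alpha> are arbitrary, so the formula also applies to modified ones.\<close>

lemma inner_objective_matching:
  assumes "\<And>i. i \<in> vues G \<Longrightarrow> m i \<in> neighbors G i"
    and "\<And>i j. i \<in> vues G \<Longrightarrow> j \<in> neighbors G i \<Longrightarrow> \<beta> i j = of_bool (j = m i)"
  shows "inner_objective G \<tau> (\<alpha>, \<beta>) = (\<Sum>i\<in>vues G. link_cost G \<tau> i (m i) (\<alpha> i) (\<alpha> (m i)))"
proof -
  have "(\<Sum>j\<in>neighbors G i. \<beta> i j * link_cost G \<tau> i j (\<alpha> i) (\<alpha> j))
      = link_cost G \<tau> i (m i) (\<alpha> i) (\<alpha> (m i))" if i: "i \<in> vues G" for i
  proof -
    have "(\<Sum>j\<in>neighbors G i. \<beta> i j * link_cost G \<tau> i j (\<alpha> i) (\<alpha> j))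
        = (\<Sum>j\<in>neighbors G i. if j = m i then link_cost G \<tau> i j (\<alpha> i) (\<alpha> j) else 0)"
      by (intro sum.cong refl) (simp add: assms(2)[OF i])
    then show ?thesis using assms(1)[OF i] by simp
  qed
  then show ?thesis by (simp add: inner_objective_def link_cost_def)
qed

lemma pair_restriction_optimal:
  assumes sym: "\<forall>i\<in>vues G. \<forall>j\<in>vues G. j \<in> neighbors G i \<longleftrightarrow> i \<in> neighbors G j"
    and opt: "is_arg_min (inner_objective G \<tau>) (inner_feasible G) (\<alpha>, \<beta>)"
    and i: "i \<in> vues G"
  obtains j where "j \<in> neighbors G i"
    and "is_arg_min (pair_objective G \<tau> i j) (pair_feasible G i j) (\<alpha> i, \<alpha> j)"
proof -
  have feas: "inner_feasible G (\<alpha>, \<beta>)"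
    \<comment> \<open>The competitors keep \<beta>, so that all objectives compared decompose along
      the same matching.\<close>
    and min: "\<And>\<alpha>'. inner_feasible G (\<alpha>', \<beta>) \<Longrightarrow>
      inner_objective G \<tau> (\<alpha>, \<beta>) \<le> inner_objective G \<tau> (\<alpha>', \<beta>)"
    using opt by (auto simp: is_arg_min_def not_less)
  obtain m where m: "\<And>k. k \<in> vues G \<Longrightarrow> m k \<in> neighbors G k"
    and inv: "\<And>k. k \<in> vues G \<Longrightarrow> m (m k) = k"
    and \<beta>: "\<And>k l. k \<in> vues G \<Longrightarrow> l \<in> neighbors G k \<Longrightarrow> \<beta> k l = of_bool (l = m k)"
    using inner_feasible_matching[OF feas sym] by blast
  define j where "j = m i"
  have j: "j \<in> vues G" "j \<noteq> i" "m i = j" "m j = i"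
    using m[OF i] inv[OF i] by (auto simp: neighbors_def j_def)
  \<comment> \<open>As \<open>m\<close> swaps \<open>i\<close> and \<open>j\<close>, the summands at
    these two indices are the two directions of one link and together form the pair
    objective.\<close>
  have split: "inner_objective G \<tau> (\<alpha>', \<beta>) = pair_objective G \<tau> i j (\<alpha>' i, \<alpha>' j)
      + (\<Sum>k\<in>vues G - {i} - {j}. link_cost G \<tau> k (m k) (\<alpha>' k) (\<alpha>' (m k)))" for \<alpha>'
  proof -
    have "inner_objective G \<tau> (\<alpha>', \<beta>) = (\<Sum>k\<in>vues G. link_cost G \<tau> k (m k) (\<alpha>' k) (\<alpha>' (m k)))"
      by (intro inner_objective_matching m \<beta>)
    then show ?thesis
      using i j by (simp add: sum.remove[of _ i] sum.remove[of _ j] pair_objective_def link_cost_def)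
  qed
  have "pair_objective G \<tau> i j (\<alpha> i, \<alpha> j) \<le> pair_objective G \<tau> i j (a, b)"
    if "pair_feasible G i j (a, b)" for a b
  proof -
    define \<alpha>' where "\<alpha>' = \<alpha>(i := a, j := b)"
    have "inner_feasible G (\<alpha>', \<beta>)"
      using feas that by (auto simp: inner_feasible_def pair_feasible_def \<alpha>'_def)
    moreover have "(\<Sum>k\<in>vues G - {i} - {j}. link_cost G \<tau> k (m k) (\<alpha>' k) (\<alpha>' (m k)))
        = (\<Sum>k\<in>vues G - {i} - {j}. link_cost G \<tau> k (m k) (\<alpha> k) (\<alpha> (m k)))"
    proof (rule sum.cong[OF refl])
      fix k assume k: "k \<in> vues G - {i} - {j}"
      \<comment> \<open>If \<open>m k\<close> were \<open>i\<close> or \<open>j\<close>, applying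
        \<open>m\<close> once more would give \<open>k = j\<close> or \<open>k = i\<close>. Hence no
        remaining summand sees the replaced policies.\<close>
      then have "m k \<noteq> i" "m k \<noteq> j" using inv[of k] j by auto
      with k show "link_cost G \<tau> k (m k) (\<alpha>' k) (\<alpha>' (m k)) = link_cost G \<tau> k (m k) (\<alpha> k) (\<alpha> (m k))"
        by (simp add: \<alpha>'_def)
    qed
    \<comment> \<open>The equal remainders cancel; \<open>j \<noteq> i\<close> ensures that the
      second update does not overwrite the first.\<close>
    ultimately show ?thesis using min[of \<alpha>'] split[of \<alpha>] split[of \<alpha>'] j(2) by (simp add: \<alpha>'_def)
  qed
  moreover have "pair_feasible G i j (\<alpha> i, \<alpha> j)"
    using feas i j(1) by (simp add: inner_feasible_def pair_feasible_def)
  ultimately have "is_arg_min (pair_objective G \<tau> i j) (pair_feasible G i j) (\<alpha> i, \<alpha> j)"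
    by (auto simp: is_arg_min_def not_less)
  with m[OF i] show thesis by (intro that[of j]) (simp_all add: j_def)
qed

text \<open>A pair subproblem may have several minimizers, so the optimal sub-policy is read as the
  first component of some minimizer. The witness is the restriction of the given optimum to
  \<open>i\<close> and its partner.\<close>

theorem proposition1:
  fixes G :: network
    and \<tau> :: "nat \<Rightarrow> real"
    and \<alpha> :: "nat \<Rightarrow> kbc_policy"
    and \<beta> :: "nat \<Rightarrow> nat \<Rightarrow> real"
  assumes zipf: "\<forall>i\<in>vues G. zipf_skewness G i \<ge> 0"
    and rank: "\<forall>i\<in>vues G. bij_betw (pop_rank G i) (kbs G) (kbs G)"
    and neighbors_sym: "\<forall>i\<in>vues G. \<forall>j\<in>vues G. j \<in> neighbors G i \<longleftrightarrow> i \<in> neighbors G j"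
    and steady_state: "\<forall>i\<in>vues G. \<forall>j\<in>neighbors G i. \<forall>a b.
      vue_feasible G i a \<and> vue_feasible G j b \<longrightarrow> eff_rate G i a b * interp_mean G i j a b < 1"
    and dual: "\<forall>i\<in>vues G. \<tau> i \<ge> 0"
    and opt: "is_arg_min (inner_objective G \<tau>) (inner_feasible G) (\<alpha>, \<beta>)"
  shows "\<forall>i\<in>vues G. \<exists>j\<in>neighbors G i. \<exists>\<alpha>i \<alpha>j.
    is_arg_min (pair_objective G \<tau> i j) (pair_feasible G i j) (\<alpha>i, \<alpha>j) \<and> \<alpha>i = \<alpha> i"
  using pair_restriction_optimal[OF neighbors_sym opt] by metis

end
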